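(* Let $G=(V,E,\omega)$ be a graph and $S\in st(G)$. If each vertex of $G$ lies on a branch in $\mathcal{B}_S(G)$, then $G$ and its branch expansion $\mathcal{X}_S(G)$ have the same weight set, $\mathcal{R}_S(\mathcal{X}_S(G))=\mathcal{R}_S(G)$, and $|\mathcal{X}_S(G)|\ge|G|$. Moreover, $$\det\big(M(\mathcal{X}_S(G))-\lambda I\big)=\det\big(M(G)-\lambda I\big)\prod_{v_i\in\bar S}\big(\omega(e_{ii})-\lambda\big)^{n_i-1},$$ where $n_i$ is the number of branches in $\mathcal{B}_S(G)$ containing $v_i$.
   Context: Let $\mathbb{W}$ be the field of rational functions in a complex variable $\lambda$ with complex coefficients. A graph $G=(V,E,\omega)$ is a finite directed graph with vertex set $V$, edges $E$ (loops allowed, at most one edge $e_{ij}$ from $v_i$ to $v_j$), weights $\omega:E\to\mathbb{W}\setminus\{0\}$, $\omega(e_{ij})=0$ for non-edges; $M(G)_{ij}=\omega(e_{ij})$; $|G|$ is the number of vertices; the weight set of $G$ is $\omega(E)$. $\bar S=V\setminus S$; $\ell(G)$ is $G$ without loops. A path is a sequence of distinct vertices $u_1,\dots,u_m$ ($m\ge2$) with edges $u_k\to u_{k+1}$; a cycle is the same with $u_1=u_m$, $u_1,\dots,u_{m-1}$ distinct; $u_2,\dots,u_{m-1}$ are interior. A nonempty $S\subseteq V$ is a structural set ($S\in st(G)$) if $\ell(G)|_{\bar S}$ has no cycles and $\omega(e_{ii})\neq\lambda$ for $v_i\in\bar S$. For $v_i,v_j\in S$, $\mathcal{B}_{ij}(G;S)$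 is the set of paths or cycles from $v_i$ to $v_j$ with no interior vertex in $S$, and $\mathcal{B}_S(G)=\bigcup_{i,j}\mathcal{B}_{ij}(G;S)$ is the set of branches. For $\beta=u_1,\dots,u_m$, $\mathcal{P}_\omega(\beta)=\omega(u_1u_2)\prod_{k=2}^{m-1}\frac{\omega(u_ku_{k+1})}{\lambda-\omega(u_ku_k)}$, and the isospectral reduction $\mathcal{R}_S(G)$ is the graph on $S$ with an edge $v_i\to v_j$ iff $\mathcal{B}_{ij}(G;S)\ne\emptyset$, of weight $\sum_{\beta\in\mathcal{B}_{ij}(G;S)}\mathcal{P}_\omega(\beta)$. For a branch $\beta=u_1,\dots,u_m$ let $\Omega(\beta)$ be the sequence $\omega(u_1u_2),\omega(u_2u_2),\omega(u_2u_3),\omega(u_3u_3),\dots,\omega(u_{m-1}u_{m-1}),\omega(u_{m-1}u_m)$ (with $0$ for absent loops). Two branches are independent if they share no interior vertex. For $S=\{v_1,\dots,v_m\}\in st(G)$ the branch expansion $\mathcal{X}_S(G)$ is the graph (unique up to labeling of the vertices outside $S$) containing $S$ in its vertex set, with $S\in st(\mathcal{X}_S(G))$, such that: (i) for all $i,j$ there are bijections $b_{ij}:\mathcal{B}_{ij}(\mathcal{X}_S(G);S)\to\mathcal{B}_{ij}(G;S)$ with $\Omega(\gamma)=\Omega(b_{ij}(\gamma))$; (ii) the branches in $\mathcal{B}_S(\mathcal{X}_S(G))$ are pairwise independent; (iii) each vertex of $\mathcal{X}_S(G)$ lies on a branch in $\mathcal{B}_S(\mathcal{X}_S(G))$. 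*)

theory Defs
  imports "Jordan_Normal_Form.Determinant" "HOL-Computational_Algebra.Fraction_Field"
begin

type_synonym rf = "complex poly fract"

definition lam :: rf where "lam = Fract [:0, 1:] 1"

text \<open>A graph is given by its number of vertices n (vertex set {0..<n}) and its
  weight function w; w i j = 0 encodes the absence of the edge i -> j.\<close>
type_synonym graph = "nat \<times> (nat \<Rightarrow> nat \<Rightarrow> rf)"

definition nv :: "graph \<Rightarrow> nat" where "nv G = fst G"
definition wt :: "graph \<Rightarrow> nat \<Rightarrow> nat \<Rightarrow> rf" where "wt G = snd G"

definition wf_graph :: "graph \<Rightarrow> bool" where
  "wf_graph G \<longleftrightarrow> (\<forall>i j. (i \<ge> nv G \<or> j \<ge> nv G) \<longrightarrow> wt G i j = 0)"

definition edge :: "graph \<Rightarrow> nat \<Rightarrow> nat \<Rightarrow> bool" where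
  "edge G i j \<longleftrightarrow> i < nv G \<and> j < nv G \<and> wt G i j \<noteq> 0"

definition weight_set :: "graph \<Rightarrow> rf set" where
  "weight_set G = {wt G i j | i j. edge G i j}"

definition adj_mat :: "graph \<Rightarrow> rf mat" where
  "adj_mat G = mat (nv G) (nv G) (\<lambda>(i, j). wt G i j)"

definition consec_edges :: "graph \<Rightarrow> nat list \<Rightarrow> bool" where
  "consec_edges G p \<longleftrightarrow> (\<forall>k. k + 1 < length p \<longrightarrow> edge G (p ! k) (p ! (k + 1)))"

definition is_path :: "graph \<Rightarrow> nat list \<Rightarrow> bool" where
  "is_path G p \<longleftrightarrow> length p \<ge> 2 \<and> distinct p \<and> consec_edges G p"

definition is_cycle :: "graph \<Rightarrow> nat list \<Rightarrow> bool" where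
  "is_cycle G p \<longleftrightarrow> length p \<ge> 2 \<and> hd p = last p \<and> distinct (butlast p) \<and> consec_edges G p"

definition interior :: "nat list \<Rightarrow> nat set" where
  "interior p = set (butlast (tl p))"

definition structural :: "graph \<Rightarrow> nat set \<Rightarrow> bool" where
  "structural G S \<longleftrightarrow> S \<noteq> {} \<and> S \<subseteq> {0..<nv G} \<and>
     \<not> (\<exists>p. length p \<ge> 2 \<and> hd p = last p \<and> distinct (butlast p) \<and>
            set p \<subseteq> {0..<nv G} - S \<and>
            (\<forall>k. k + 1 < length p \<longrightarrow> p ! k \<noteq> p ! (k + 1) \<and> edge G (p ! k) (p ! (k + 1)))) \<and>
     (\<forall>i \<in> {0..<nv G} - S. wt G i i \<noteq> lam)"

definition branches_ij :: "graph \<Rightarrow> nat set \<Rightarrow> nat \<Rightarrow> nat \<Rightarrow> nat list set" where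
  "branches_ij G S i j = {p. (is_path G p \<or> is_cycle G p) \<and> hd p = i \<and> last p = j \<and>
                             interior p \<inter> S = {}}"

definition branches :: "graph \<Rightarrow> nat set \<Rightarrow> nat list set" where
  "branches G S = (\<Union>i\<in>S. \<Union>j\<in>S. branches_ij G S i j)"

definition path_weight :: "graph \<Rightarrow> nat list \<Rightarrow> rf" where
  "path_weight G p = wt G (p ! 0) (p ! 1) *
     (\<Prod>k\<in>{1..<length p - 1}. wt G (p ! k) (p ! (k + 1)) / (lam - wt G (p ! k) (p ! k)))"

text \<open>The isospectral reduction R_S(G), as a partial weight function on S x S:
  None = no edge, Some x = edge of weight x.\<close>
definition reduction :: "graph \<Rightarrow> nat set \<Rightarrow> nat \<Rightarrow> nat \<Rightarrow> rf option" where
  "reduction G S i j = (if i \<in> S \<and> j \<in> S \<and> branches_ij G S i j \<noteq> {}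
       then Some (\<Sum>p\<in>branches_ij G S i j. path_weight G p) else None)"

definition Omega :: "graph \<Rightarrow> nat list \<Rightarrow> rf list" where
  "Omega G p = wt G (p ! 0) (p ! 1) #
     concat (map (\<lambda>k. [wt G (p ! k) (p ! k), wt G (p ! k) (p ! (k + 1))]) [1..<length p - 1])"

definition independent :: "nat list \<Rightarrow> nat list \<Rightarrow> bool" where
  "independent p q \<longleftrightarrow> interior p \<inter> interior q = {}"

text \<open>H is (a labeling of) the branch expansion X_S(G): conditions (i)-(iii).\<close>
definition is_branch_expansion :: "graph \<Rightarrow> nat set \<Rightarrow> graph \<Rightarrow> bool" where
  "is_branch_expansion G S H \<longleftrightarrow> wf_graph H \<and> S \<subseteq> {0..<nv H} \<and> structural H S \<and>
     (\<forall>i\<in>S. \<forall>j\<in>S. \<exists>b. bij_betw b (branches_ij H S i j) (branches_ij G S i j) \<and>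
          (\<forall>q\<in>branches_ij H S i j. Omega H q = Omega G (b q))) \<and>
     (\<forall>p\<in>branches H S. \<forall>q\<in>branches H S. p \<noteq> q \<longrightarrow> independent p q) \<and>
     (\<forall>v < nv H. \<exists>p\<in>branches H S. v \<in> set p)"

end

theory Submission
  imports Defs
begin

text \<open>
  Since there are no cycles outside \<open>S\<close>, every vertex has finitely many weighted paths
  through the complement of \<open>S\<close> into \<open>S\<close>. Let \<open>F\<close> be the matrix whose entry \<open>(u, j)\<close> is the total
  weight of such paths from \<open>u\<close> to \<open>j\<close>. Multiplying \<open>M(G) - \<lambda>I\<close> on the right by the unimodular
  matrix that has the columns of \<open>F\<close> at \<open>S\<close> and unit columns elsewhere yields the block form with
  \<open>R\<^sub>S(G) - \<lambda>I\<close> on \<open>S\<close>, zero below it and a block that is triangular for the acyclic order on the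
  complement of \<open>S\<close>. Hence \<open>det (M(G) - \<lambda>I)\<close> is \<open>det (R\<^sub>S(G) - \<lambda>I)\<close> times the product of the loop
  factors outside \<open>S\<close>. The reduction depends only on the sequences \<open>\<Omega>(\<beta>)\<close>, so it is the same for
  the branch expansion. The vertices of the expansion outside \<open>S\<close> correspond to the interior
  positions on the branches of \<open>G\<close>, and exactly \<open>n\<^sub>i\<close> of these positions are occupied by \<open>v\<^sub>i\<close>;
  this gives the comparison of the loop factors and of the numbers of vertices.
\<close>

subsection \<open>Branches as lists of steps outside the structural set\<close>

text \<open>Steps start outside \<open>S\<close>, so a list of steps meets \<open>S\<close> at most in its last element, and
  acyclicity makes it distinct. A branch is thus a vertex of \<open>S\<close> followed by such a list.\<close>

definition step :: "graph \<Rightarrow> nat set \<Rightarrow> nat \<Rightarrow> nat \<Rightarrow> bool" where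
  "step G S u v \<longleftrightarrow> u \<notin> S \<and> u \<noteq> v \<and> edge G u v"

definition tails :: "graph \<Rightarrow> nat set \<Rightarrow> nat \<Rightarrow> nat \<Rightarrow> nat list set" where
  "tails G S u j = {q. q \<noteq> [] \<and> hd q = u \<and> last q = j \<and> successively (step G S) q}"

lemma consec_edges_iff: "consec_edges G p \<longleftrightarrow> successively (edge G) p"
  by (simp add: consec_edges_def successively_conv_nth)

text \<open>The pairs are reversed so that induction at \<open>u\<close> may use the claim for all
  successors of \<open>u\<close>. Steps may end in \<open>S\<close> but never leave it, so an
  endless sequence of steps would stay in the complement, where a structural set permits no
  cycle.\<close>

lemma structural_wf:
  assumes "structural G S"
  shows "wf {(v, u). step G S u v}"
  unfolding wf_eq_minimal
proof (intro allI impI, rule ccontr)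
  fix Q and x :: nat
  assume "x \<in> Q" and "\<not> (\<exists>z\<in>Q. \<forall>y. (y, z) \<in> {(v, u). step G S u v} \<longrightarrow> y \<notin> Q)"
  \<comment> \<open>Iterating a successor function inside \<open>Q\<close> up to the first repetition closes a cycle.\<close>
  then obtain f where f: "\<And>z. z \<in> Q \<Longrightarrow> f z \<in> Q \<and> step G S z (f z)"
    by (auto; metis)
  define s where "s k = (f ^^ k) x" for k
  have sQ: "s k \<in> Q" for k
    unfolding s_def using f \<open>x \<in> Q\<close> by (induction k) auto
  have st: "step G S (s k) (s (Suc k))" for k
    using f[OF sQ[of k]] by (simp add: s_def)
  have s_in: "s k \<in> {0..<nv G} - S" for k
    using st[of k] by (auto simp: step_def edge_def)
  \<comment> \<open>There are \<open>nv G + 1\<close> indices, but all values lie among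
    \<open>nv G\<close> vertices.\<close>
  have "\<not> inj_on s {0..nv G}"
  proof
    assume "inj_on s {0..nv G}"
    moreover have "s ` {0..nv G} \<subseteq> {0..<nv G}"
      using s_in by auto
    ultimately have "card {0..nv G} \<le> card {0..<nv G}"
      by (intro card_inj_on_le) auto
    then show False by simp
  qed
  then have ex: "\<exists>j. \<exists>i<j. s i = s j"
    unfolding inj_on_def by (metis linorder_neqE_nat)
  \<comment> \<open>Minimality of \<open>j\<close> makes the closed walk from \<open>i\<close> to
    \<open>j\<close> a genuine cycle, with no repetition before its end.\<close>
  define j where "j = (LEAST j. \<exists>i<j. s i = s j)"
  obtain i where i: "i < j" "s i = s j"
    using LeastI_ex[OF ex] unfolding j_def by blast
  have "inj_on s {0..<j}"
    unfolding inj_on_def using not_less_Least[of _ "\<lambda>j. \<exists>i<j. s i = s j"]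
    by (metis atLeastLessThan_iff j_def linorder_neqE_nat)
  then have inj: "inj_on s {i..<j}"
    by (rule inj_on_subset) auto
  let ?p = "map s [i..<Suc j]"
  have nth: "?p ! k = s (i + k)" if "k < Suc j - i" for k
    using that by (simp add: nth_map[of k "[i..<Suc j]"] del: upt_Suc)
  have "length ?p \<ge> 2" using i by simp
  moreover have "hd ?p = last ?p" using i by (simp add: hd_map del: upt_Suc) (simp add: last_map)
  moreover have "distinct (butlast ?p)" using i inj by (simp add: distinct_map)
  moreover have "set ?p \<subseteq> {0..<nv G} - S" unfolding set_map using s_in by (rule image_subsetI)
  moreover have "?p ! k \<noteq> ?p ! (k + 1) \<and> edge G (?p ! k) (?p ! (k + 1))" if "k + 1 < length ?p" for k
  proof -
    have "?p ! k = s (i + k)" "?p ! (k + 1) = s (Suc (i + k))"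
      using that nth[of k] nth[of "k + 1"] by auto
    then show ?thesis using st[of "i + k"] by (auto simp: step_def)
  qed
  ultimately show False using assms unfolding structural_def by blast
qed

text \<open>Passing to the transitive closure of \<open>step\<close> relates all pairs of entries
  instead of only neighbours, and acyclicity makes this closure irreflexive.\<close>

lemma distinct_steps:
  assumes "structural G S" and "successively (step G S) q"
  shows "distinct q"
proof -
  have "acyclic {(v, u). step G S u v}"
    using wf_acyclic structural_wf assms(1) by blast
  then have "acyclicP (step G S)"
    using acyclic_converse by (fastforce simp: converse_unfold)
  then have irr: "\<not> (step G S)\<^sup>+\<^sup>+ x x" for x
    by (auto simp: acyclic_def tranclp_unfold)
  have "successively (step G S)\<^sup>+\<^sup>+ q"
    using assms(2) by (rule successively_mono) auto
  then have "sorted_wrt (step G S)\<^sup>+\<^sup>+ q"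
    by (subst (asm) successively_conv_sorted_wrt) (auto intro: transpI)
  then show ?thesis using irr by (induction q) auto
qed

text \<open>The last entry is kept apart because a one-element list involves no edge, so its entry
  may be any number.\<close>

lemma steps_set: "successively (step G S) q \<Longrightarrow> q \<noteq> [] \<Longrightarrow> set q \<subseteq> insert (last q) {0..<nv G}"
  by (induction q) (auto simp: successively_Cons step_def edge_def)

lemma steps_butlast: "successively (step G S) q \<Longrightarrow> set (butlast q) \<inter> S = {}"
  by (induction q) (auto simp: successively_Cons step_def)

lemma interior_Cons: "interior (i # q) = set (butlast q)"
  by (simp add: interior_def)

text \<open>Dropping the first vertex treats paths and cycles alike: what remains is distinct in
  both cases and avoids \<open>S\<close> except at its end. Conversely, acyclicity supplies the
  distinctness.\<close>

lemma branches_ij_eq: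
  assumes "structural G S" "i \<in> S" "j \<in> S"
  shows "branches_ij G S i j =
    {i # q | q. q \<noteq> [] \<and> edge G i (hd q) \<and> last q = j \<and> successively (step G S) q}"
proof (intro equalityI subsetI)
  fix p assume "p \<in> branches_ij G S i j"
  then have p: "is_path G p \<or> is_cycle G p" "hd p = i" "last p = j" "interior p \<inter> S = {}"
    by (auto simp: branches_ij_def)
  have "length p \<ge> 2" using p by (auto simp: is_path_def is_cycle_def)
  then obtain q where q: "p = i # q" "q \<noteq> []"
    using p(2) by (cases p) (fastforce simp: Suc_le_eq)+
  have lq: "last q = j" using p q by auto
  have q': "q = butlast q @ [j]" using q lq by auto
  have dist: "distinct q"
    using p(1)
  proof
    assume "is_path G p" then show ?thesis by (simp add: is_path_def q)
  next
    assume "is_cycle G p"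
    then have "distinct (i # butlast q)" "i = j"
      using q lq by (auto simp: is_cycle_def)
    then have "distinct (butlast q @ [j])" by simp
    then show ?thesis using q' by simp
  qed
  have suc: "successively (edge G) (i # q)"
    using p(1) by (auto simp: is_path_def is_cycle_def consec_edges_iff q)
  have "successively (step G S) q"
    unfolding successively_conv_nth
  proof (intro allI impI)
    fix k assume k: "Suc k < length q"
    then have "q ! k \<in> set (butlast q)"
      using nth_butlast[of k q] nth_mem[of k "butlast q"] by simp
    then have "q ! k \<notin> S" using p(4) by (auto simp: q interior_Cons)
    moreover have "q ! k \<noteq> q ! Suc k" using dist k by (simp add: nth_eq_iff_index_eq)
    moreover have "edge G (q ! k) (q ! Suc k)"
      using suc k q by (auto simp: successively_Cons successively_conv_nth)
    ultimately show "step G S (q ! k) (q ! Suc k)" by (simp add: step_def)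
  qed
  then show "p \<in> {i # q | q. q \<noteq> [] \<and> edge G i (hd q) \<and> last q = j \<and> successively (step G S) q}"
    using q suc lq by (auto simp: successively_Cons)
next
  fix p assume "p \<in> {i # q | q. q \<noteq> [] \<and> edge G i (hd q) \<and> last q = j \<and> successively (step G S) q}"
  then obtain q where q: "p = i # q" "q \<noteq> []" "edge G i (hd q)" "last q = j" "successively (step G S) q"
    by auto
  have dist: "distinct q" using distinct_steps assms(1) q(5) by blast
  have nS: "set (butlast q) \<inter> S = {}" using steps_butlast q(5) by blast
  have q': "q = butlast q @ [j]" using q by auto
  have "successively (edge G) q"
    using q(5) by (rule successively_mono) (auto simp: step_def)
  then have ce: "consec_edges G p"
    using q by (auto simp: consec_edges_iff successively_Cons)
  \<comment> \<open>Since \<open>i\<close> lies in \<open>S\<close>, it can recur in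
    \<open>q\<close> only as the last entry, and then the list is a cycle.\<close>
  have "i \<notin> set (butlast q)" using nS assms(2) by auto
  moreover have "set q = insert j (set (butlast q))"
    by (subst q') simp
  ultimately have "i \<notin> set q" if "i \<noteq> j"
    using that by simp
  moreover have "length p \<ge> 2"
    using q by (cases q) auto
  ultimately have "is_path G p \<or> is_cycle G p"
    using dist ce q \<open>i \<notin> set (butlast q)\<close>
    by (cases "i = j") (simp_all add: is_path_def is_cycle_def distinct_butlast)
  then show "p \<in> branches_ij G S i j"
    using q nS by (auto simp: branches_ij_def interior_Cons)
qed

section \<open>Finiteness of the branches, and tails split at their first step\<close>

lemma branches_eq:
  assumes "structural G S"
  shows "branches G S =
    {i # q | i q. i \<in> S \<and> q \<noteq> [] \<and> edge G i (hd q) \<and> last q \<in> S \<and> successively (step G S) q}"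
  unfolding branches_def using branches_ij_eq[OF assms] by auto

lemma branches_subset:
  assumes "structural G S"
  shows "branches G S \<subseteq> (\<lambda>(i, q). i # q) ` ({0..<nv G} \<times> {q. set q \<subseteq> {0..<nv G} \<and> distinct q})"
proof
  fix p assume "p \<in> branches G S"
  then obtain i q where p: "p = i # q" "i \<in> S" "q \<noteq> []" "last q \<in> S" "successively (step G S) q"
    by (auto simp: branches_eq[OF assms])
  have S: "S \<subseteq> {0..<nv G}" using assms by (simp add: structural_def)
  then show "p \<in> (\<lambda>(i, q). i # q) ` ({0..<nv G} \<times> {q. set q \<subseteq> {0..<nv G} \<and> distinct q})"
    using p steps_set[OF p(5,3)] distinct_steps[OF assms p(5)] by fastforce
qed

lemma finite_branches: "structural G S \<Longrightarrow> finite (branches G S)"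
  by (rule finite_subset[OF branches_subset]) (auto intro!: finite_imageI finite_cartesian_product finite_subset_distinct)

lemma finite_tails:
  assumes "structural G S" "j \<in> S"
  shows "finite (tails G S u j)"
proof (rule finite_subset)
  show "tails G S u j \<subseteq> {q. set q \<subseteq> {0..<nv G} \<and> distinct q}"
  proof
    fix q assume "q \<in> tails G S u j"
    then have "q \<noteq> []" "last q = j" "successively (step G S) q" by (auto simp: tails_def)
    then show "q \<in> {q. set q \<subseteq> {0..<nv G} \<and> distinct q}"
      using steps_set[of G S q] distinct_steps[OF assms(1), of q] assms by (auto simp: structural_def)
  qed
qed (simp add: finite_subset_distinct)

lemma tails_S: "u \<in> S \<Longrightarrow> tails G S u j = (if u = j then {[j]} else {})"
proof -
  assume "u \<in> S"
  have "q = [u]" if "q \<in> tails G S u j" for q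
    using that \<open>u \<in> S\<close> by (cases q) (auto simp: tails_def successively_Cons step_def)
  moreover have "[u] \<in> tails G S u j \<longleftrightarrow> u = j"
    by (simp add: tails_def)
  ultimately have "q \<in> tails G S u j \<longleftrightarrow> q = [u] \<and> u = j" for q
    by blast
  then show ?thesis by (simp add: set_eq_iff)
qed

text \<open>A tail that starts outside \<open>S\<close> and ends in \<open>S\<close> cannot be
  trivial, so it begins with a step. This is the source of the linear recursion for
  \<open>tails_sum\<close>.\<close>

lemma tails_not_S:
  assumes "u \<notin> S" "j \<in> S"
  shows "tails G S u j = (\<Union>v\<in>{v. step G S u v}. (#) u ` tails G S v j)"
proof (intro equalityI subsetI)
  fix p assume "p \<in> tails G S u j"
  then obtain q where q: "p = u # q" "last (u # q) = j" "successively (step G S) (u # q)"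
    by (cases p) (auto simp: tails_def)
  then have "q \<noteq> []" using assms by auto
  with q show "p \<in> (\<Union>v\<in>{v. step G S u v}. (#) u ` tails G S v j)"
    by (auto simp: tails_def successively_Cons)
qed (auto simp: tails_def successively_Cons)

lemma branches_ij_tails:
  assumes "structural G S" "i \<in> S" "j \<in> S"
  shows "branches_ij G S i j = (\<Union>v\<in>{v. edge G i v}. (#) i ` tails G S v j)"
  unfolding branches_ij_eq[OF assms] tails_def by auto

subsection \<open>The determinant of the isospectral reduction\<close>

text \<open>A permutation with nonzero Leibniz term fixes every index outside \<open>S\<close>: by well-founded
  induction \<open>p (p i) = p i\<close> whenever \<open>p i \<noteq> i\<close>.\<close>

lemma det_triangular_outside:
  fixes M :: "'a::comm_ring_1 mat"
  assumes M: "M \<in> carrier_mat n n" and S: "S \<subseteq> {0..<n}" and R: "wf R"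
    and tri: "\<And>i j. i < n \<Longrightarrow> j < n \<Longrightarrow> i \<notin> S \<Longrightarrow> i \<noteq> j \<Longrightarrow> M $$ (i, j) \<noteq> 0 \<Longrightarrow> j \<notin> S \<and> (j, i) \<in> R"
  shows "det M = (\<Sum>p | p permutes S. signof p * (\<Prod>i\<in>S. M $$ (i, p i))) * (\<Prod>i\<in>{0..<n} - S. M $$ (i, i))"
proof -
  let ?t = "\<lambda>p. signof p * (\<Prod>i = 0..<n. M $$ (i, p i))"
  have "det M = sum ?t {p. p permutes {0..<n}}"
    by (rule det_def'[OF M])
  also have "\<dots> = sum ?t {p. p permutes S}"
  proof (rule sum.mono_neutral_right)
    show "finite {p. p permutes {0..<n}}" by (simp add: finite_permutations)
    show "{p. p permutes S} \<subseteq> {p. p permutes {0..<n}}" using S permutes_subset by blast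
    show "\<forall>p\<in>{p. p permutes {0..<n}} - {p. p permutes S}. ?t p = 0"
    proof
      fix p assume p: "p \<in> {p. p permutes {0..<n}} - {p. p permutes S}"
      then have perm: "p permutes {0..<n}" by simp
      have "\<exists>i\<in>{0..<n}. M $$ (i, p i) = 0"
      proof (rule ccontr)
        assume nz: "\<not> (\<exists>i\<in>{0..<n}. M $$ (i, p i) = 0)"
        have fixed: "i < n \<longrightarrow> i \<notin> S \<longrightarrow> p i = i" for i
          using R
        proof (induction i rule: wf_induct_rule)
          case (less i)
          show ?case
          proof (intro impI, rule ccontr)
            assume i: "i < n" "i \<notin> S" "p i \<noteq> i"
            have pn: "p i < n" using perm i(1) permutes_in_image by fastforce
            have "M $$ (i, p i) \<noteq> 0" using nz i(1) by auto
            with tri[of i "p i"] i pn have "p i \<notin> S" "(p i, i) \<in> R" by auto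
            with less pn have "p (p i) = p i" by blast
            then show False using i(3) perm by (metis permutes_def)
          qed
        qed
        then have "p permutes S" using perm by (intro permutes_superset[OF perm]) auto
        with p show False by simp
      qed
      then show "?t p = 0" by (metis finite_atLeastLessThan mult_zero_right prod_zero)
    qed
  qed
  also have "\<dots> = (\<Sum>p | p permutes S. (signof p * (\<Prod>i\<in>S. M $$ (i, p i))) * (\<Prod>i\<in>{0..<n} - S. M $$ (i, i)))"
  proof (rule sum.cong[OF refl])
    fix p assume "p \<in> {p. p permutes S}"
    then have "(\<Prod>i\<in>{0..<n} - S. M $$ (i, p i)) = (\<Prod>i\<in>{0..<n} - S. M $$ (i, i))"
      by (intro prod.cong) (auto simp: permutes_not_in)
    moreover have "(\<Prod>i = 0..<n. M $$ (i, p i)) =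
        (\<Prod>i\<in>{0..<n} - S. M $$ (i, p i)) * (\<Prod>i\<in>S. M $$ (i, p i))"
      by (rule prod.subset_diff[OF S]) simp
    ultimately show "?t p = (signof p * (\<Prod>i\<in>S. M $$ (i, p i))) * (\<Prod>i\<in>{0..<n} - S. M $$ (i, i))"
      by (simp add: mult_ac)
  qed
  also have "\<dots> = (\<Sum>p | p permutes S. signof p * (\<Prod>i\<in>S. M $$ (i, p i))) * (\<Prod>i\<in>{0..<n} - S. M $$ (i, i))"
    by (rule sum_distrib_right[symmetric])
  finally show ?thesis .
qed

section \<open>Weights of tails and the reduction as a matrix\<close>

definition tail_weight :: "graph \<Rightarrow> nat list \<Rightarrow> rf" where
  "tail_weight G q = (\<Prod>k = 0..<length q - 1. wt G (q ! k) (q ! (k + 1)) / (lam - wt G (q ! k) (q ! k)))"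

text \<open>These are the entries of the matrix \<open>F\<close>.\<close>

definition tails_sum :: "graph \<Rightarrow> nat set \<Rightarrow> nat \<Rightarrow> nat \<Rightarrow> rf" where
  "tails_sum G S u j = (\<Sum>q\<in>tails G S u j. tail_weight G q)"

lemma tail_weight_Cons:
  assumes "q \<noteq> []"
  shows "tail_weight G (u # q) = wt G u (hd q) / (lam - wt G u u) * tail_weight G q"
proof -
  obtain m where m: "length q = Suc m" using assms by (cases q) auto
  show ?thesis
    using assms by (simp add: tail_weight_def m prod.atLeast0_lessThan_Suc_shift hd_conv_nth del: prod.op_ivl_Suc)
qed

text \<open>In a tail every vertex but the last carries a denominator, its first vertex included,
  because that vertex is interior to the branch. The starting vertex \<open>i\<close> of the branch
  carries none.\<close>

lemma path_weight_Cons: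
  assumes "q \<noteq> []"
  shows "path_weight G (i # q) = wt G i (hd q) * tail_weight G q"
proof -
  obtain m where m: "length q = Suc m" using assms by (cases q) auto
  have "(\<Prod>k = 1..<Suc m. wt G ((i # q) ! k) ((i # q) ! (k + 1)) / (lam - wt G ((i # q) ! k) ((i # q) ! k)))
     = tail_weight G q"
    unfolding tail_weight_def m One_nat_def prod.shift_bounds_Suc_ivl by simp
  then show ?thesis
    using assms by (simp add: path_weight_def m hd_conv_nth)
qed

text \<open>The union is disjoint because tails from different vertices have different
  heads.\<close>

lemma sum_Cons_tails:
  assumes "structural G S" "j \<in> S" "finite V"
  shows "sum f (\<Union>v\<in>V. (#) u ` tails G S v j) = (\<Sum>v\<in>V. \<Sum>q\<in>tails G S v j. f (u # q))"
  using assms finite_tails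
  by (subst sum.UNION_disjoint) (auto simp: tails_def sum.reindex inj_on_def intro!: sum.cong)

lemma finite_edges: "finite {v. edge G u v}" "finite {v. step G S u v}"
  by (rule finite_subset[of _ "{0..<nv G}"]; auto simp: step_def edge_def)+

lemma tails_sum_S: "u \<in> S \<Longrightarrow> tails_sum G S u j = (if u = j then 1 else 0)"
  by (simp add: tails_sum_def tails_S tail_weight_def)

lemma tails_sum_not_S:
  assumes "structural G S" "j \<in> S" "u \<notin> S"
  shows "tails_sum G S u j = (\<Sum>v | step G S u v. wt G u v * tails_sum G S v j) / (lam - wt G u u)"
proof -
  have "tails_sum G S u j = (\<Sum>v | step G S u v. \<Sum>q\<in>tails G S v j. tail_weight G (u # q))"
    unfolding tails_sum_def tails_not_S[OF assms(3,2)] using assms finite_edges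
    by (intro sum_Cons_tails) auto
  also have "\<dots> = (\<Sum>v | step G S u v. wt G u v * tails_sum G S v j / (lam - wt G u u))"
    by (intro sum.cong) (auto simp: tails_sum_def sum_distrib_left sum_distrib_right sum_divide_distrib
        tail_weight_Cons tails_def intro!: sum.cong)
  finally show ?thesis by (simp add: sum_divide_distrib)
qed

definition reduction_matrix :: "graph \<Rightarrow> nat set \<Rightarrow> nat \<Rightarrow> nat \<Rightarrow> rf" where
  "reduction_matrix G S i j = (case reduction G S i j of None \<Rightarrow> 0 | Some x \<Rightarrow> x)"

lemma reduction_matrix_eq:
  assumes "wf_graph G" "structural G S" "i \<in> S" "j \<in> S"
  shows "reduction_matrix G S i j = (\<Sum>v = 0..<nv G. wt G i v * tails_sum G S v j)"
proof -
  have "i < nv G" using assms by (auto simp: structural_def)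
  \<comment> \<open>Without branches the empty sum is \<open>0\<close>, the value assigned to
    \<open>None\<close>.\<close>
  have "reduction_matrix G S i j = (\<Sum>p\<in>branches_ij G S i j. path_weight G p)"
    using assms by (simp add: reduction_matrix_def reduction_def)
  also have "\<dots> = (\<Sum>v | edge G i v. \<Sum>q\<in>tails G S v j. path_weight G (i # q))"
    unfolding branches_ij_tails[OF assms(2-4)] using assms finite_edges by (intro sum_Cons_tails) auto
  also have "\<dots> = (\<Sum>v | edge G i v. wt G i v * tails_sum G S v j)"
    by (intro sum.cong) (auto simp: tails_sum_def sum_distrib_left path_weight_Cons tails_def intro!: sum.cong)
  also have "\<dots> = (\<Sum>v = 0..<nv G. wt G i v * tails_sum G S v j)"
    using \<open>i < nv G\<close> by (intro sum.mono_neutral_left) (auto simp: edge_def)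
  finally show ?thesis .
qed

text \<open>Clear the denominator in the first-step recursion and absorb the loop term into the sum.
  In matrix terms, the rows of \<open>M(G) - \<lambda>I\<close> outside \<open>S\<close> annihilate
  the columns of \<open>F\<close>.\<close>

lemma row_sum_not_S:
  assumes "structural G S" "u < nv G" "u \<notin> S" "j \<in> S"
  shows "(\<Sum>v = 0..<nv G. wt G u v * tails_sum G S v j) = lam * tails_sum G S u j"
proof -
  have "wt G u u \<noteq> lam" using assms by (auto simp: structural_def)
  then have "lam - wt G u u \<noteq> 0" by simp
  then have "(\<Sum>v | step G S u v. wt G u v * tails_sum G S v j) = (lam - wt G u u) * tails_sum G S u j"
    using tails_sum_not_S[OF assms(1,4,3)] by simp
  moreover have "(\<Sum>v | step G S u v. wt G u v * tails_sum G S v j) =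
      (\<Sum>v\<in>{0..<nv G} - {u}. wt G u v * tails_sum G S v j)"
    using assms by (intro sum.mono_neutral_left) (auto simp: step_def edge_def)
  ultimately show ?thesis
    using assms(2) by (subst sum.remove[of _ u]) (auto simp: algebra_simps)
qed

text \<open>The Leibniz formula for the determinant of the reduction minus \<open>lam\<close> times
  the identity. It is written over permutations of \<open>S\<close> because \<open>S\<close> need
  not be an initial segment of the indices.\<close>

definition reduced_det :: "graph \<Rightarrow> nat set \<Rightarrow> rf" where
  "reduced_det G S = (\<Sum>p | p permutes S. signof p *
     (\<Prod>i\<in>S. reduction_matrix G S i (p i) - (if i = p i then lam else 0)))"

lemma det_reduction:
  assumes "wf_graph G" "structural G S"
  shows "det (adj_mat G - lam \<cdot>\<^sub>m 1\<^sub>m (nv G)) = reduced_det G S * (\<Prod>i\<in>{0..<nv G} - S. wt G i i - lam)"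
proof -
  define n where "n = nv G"
  define M where "M = adj_mat G - lam \<cdot>\<^sub>m 1\<^sub>m n"
  define P where "P = mat n n (\<lambda>(u, j). if j \<in> S then tails_sum G S u j else if u = j then 1 else 0)"
  have M[simp]: "M \<in> carrier_mat n n" and P[simp]: "P \<in> carrier_mat n n"
    by (auto simp: M_def P_def adj_mat_def n_def)
  have S: "S \<subseteq> {0..<n}" using assms(2) by (simp add: structural_def n_def)
  have Mij: "M $$ (i, j) = wt G i j - (if i = j then lam else 0)" if "i < n" "j < n" for i j
    using that by (simp add: M_def adj_mat_def n_def)
  \<comment> \<open>With the empty set in place of \<open>S\<close>, the lemma becomes the formula
    for a triangular determinant. The measure puts \<open>S\<close> below its complement: rows of
    \<open>P\<close> in \<open>S\<close> are unit rows, and the other rows have off-diagonal entries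
    only in the columns of \<open>S\<close>.\<close>
  have "det P = (\<Prod>i\<in>{0..<n} - {}. P $$ (i, i))"
  proof (subst det_triangular_outside[OF P, of "{}" "measure (\<lambda>i. if i \<in> S then 0 else 1)"])
    show "j \<notin> {} \<and> (j, i) \<in> measure (\<lambda>i. if i \<in> S then 0 else 1)"
      if "i < n" "j < n" "i \<noteq> j" "P $$ (i, j) \<noteq> 0" for i j
      using that by (auto simp: P_def tails_sum_S split: if_splits)
  qed (auto simp: signof_id)
  also have "\<dots> = 1"
    by (rule prod.neutral) (auto simp: P_def tails_sum_S)
  finally have "det P = 1" .
  have MP: "(M * P) $$ (i, j) = (if j \<in> S then (\<Sum>v = 0..<n. wt G i v * tails_sum G S v j) - lam * tails_sum G S i j
      else M $$ (i, j))" if "i < n" "j < n" for i j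
  proof -
    have "(M * P) $$ (i, j) = (\<Sum>v = 0..<n. M $$ (i, v) * P $$ (v, j))"
      using that carrier_matD[OF M] carrier_matD[OF P] by (simp add: scalar_prod_def)
    also have "\<dots> = (if j \<in> S then (\<Sum>v = 0..<n. wt G i v * tails_sum G S v j) - lam * tails_sum G S i j
        else M $$ (i, j))"
    proof (cases "j \<in> S")
      case True
      then have "(\<Sum>v = 0..<n. M $$ (i, v) * P $$ (v, j)) =
          (\<Sum>v = 0..<n. wt G i v * tails_sum G S v j - (if i = v then lam * tails_sum G S i j else 0))"
        using that by (intro sum.cong) (auto simp: Mij P_def algebra_simps)
      also have "\<dots> = (\<Sum>v = 0..<n. wt G i v * tails_sum G S v j) - lam * tails_sum G S i j"
        using that by (simp add: sum_subtractf)
      finally show ?thesis using True by simp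
    next
      case False
      then have "(\<Sum>v = 0..<n. M $$ (i, v) * P $$ (v, j)) = (\<Sum>v = 0..<n. if v = j then M $$ (i, j) else 0)"
        using that by (intro sum.cong) (auto simp: P_def)
      then show ?thesis using that False by simp
    qed
    finally show ?thesis .
  qed
  \<comment> \<open>On \<open>S\<close> the matrix \<open>F\<close> is the identity, so the
    subtracted term is \<open>lam\<close> on the diagonal.\<close>
  have MP_in: "(M * P) $$ (i, j) = reduction_matrix G S i j - (if i = j then lam else 0)" if "i \<in> S" "j \<in> S" for i j
  proof -
    have "i < n" "j < n" using that S by auto
    then show ?thesis
      using that by (simp add: MP reduction_matrix_eq[OF assms] tails_sum_S n_def)
  qed
  have MP_out: "(M * P) $$ (i, j) = (if j \<in> S then 0 else M $$ (i, j))" if "i < n" "j < n" "i \<notin> S" for i j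
    using that row_sum_not_S[OF assms(2), of i j] by (simp add: MP n_def)
  have "det M = det (M * P)"
    by (simp add: det_mult[OF M P] \<open>det P = 1\<close>)
  also have "\<dots> = (\<Sum>p | p permutes S. signof p * (\<Prod>i\<in>S. (M * P) $$ (i, p i))) * (\<Prod>i\<in>{0..<n} - S. (M * P) $$ (i, i))"
  proof (rule det_triangular_outside)
    show "M * P \<in> carrier_mat n n" by (rule mult_carrier_mat[OF M P])
    show "wf {(v, u). step G S u v}" by (rule structural_wf[OF assms(2)])
    \<comment> \<open>In a row outside \<open>S\<close> the columns of \<open>S\<close> have been
      cleared, and a nonzero off-diagonal entry elsewhere is the weight of a step.\<close>
    show "j \<notin> S \<and> (j, i) \<in> {(v, u). step G S u v}"
      if "i < n" "j < n" "i \<notin> S" "i \<noteq> j" "(M * P) $$ (i, j) \<noteq> 0" for i j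
      using that by (auto simp: MP_out Mij step_def edge_def n_def split: if_splits)
  qed (rule S)
  also have "(\<Prod>i\<in>{0..<n} - S. (M * P) $$ (i, i)) = (\<Prod>i\<in>{0..<n} - S. wt G i i - lam)"
    by (intro prod.cong) (auto simp: MP_out Mij)
  also have "(\<Sum>p | p permutes S. signof p * (\<Prod>i\<in>S. (M * P) $$ (i, p i))) = reduced_det G S"
    unfolding reduced_det_def
    by (intro sum.cong refl arg_cong2[of _ _ _ _ times] prod.cong) (auto simp: MP_in permutes_in_image)
  finally show ?thesis by (simp add: M_def n_def)
qed

subsection \<open>Invariants of a branch expansion\<close>

text \<open>A vertex shared by several branches yields one position on each of them, so positions
  count the vertices outside \<open>S\<close> with multiplicity.\<close>

definition positions :: "graph \<Rightarrow> nat set \<Rightarrow> (nat list \<times> nat) set" where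
  "positions G S = {(p, k). p \<in> branches G S \<and> 1 \<le> k \<and> k + 1 < length p}"

text \<open>A branch with \<open>m\<close> vertices has \<open>m - 1\<close> edges and
  \<open>m - 2\<close> interior vertices. Hence \<open>Omega\<close> determines the length of the
  branch.\<close>

lemma length_Omega: "length p \<ge> 2 \<Longrightarrow> length (Omega G p) = 2 * length p - 3"
  by (simp add: Omega_def length_concat comp_def sum_list_triv)

lemma Omega_eq_length:
  "Omega G p = Omega H q \<Longrightarrow> length p \<ge> 2 \<Longrightarrow> length q \<ge> 2 \<Longrightarrow> length p = length q"
  using length_Omega[of p G] length_Omega[of q H] by simp

text \<open>After its first entry \<open>Omega\<close> consists of blocks of length two, so equal
  concatenations have equal blocks.\<close>

lemma Omega_eq_iff:
  assumes "length p = length q" "length q \<ge> 2"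
  shows "Omega G p = Omega H q \<longleftrightarrow>
    (\<forall>k. k + 1 < length q \<longrightarrow> wt G (p ! k) (p ! (k + 1)) = wt H (q ! k) (q ! (k + 1))) \<and>
    (\<forall>k. 1 \<le> k \<longrightarrow> k + 1 < length q \<longrightarrow> wt G (p ! k) (p ! k) = wt H (q ! k) (q ! k))"
    (is "_ \<longleftrightarrow> (\<forall>k. _ \<longrightarrow> ?e k) \<and> (\<forall>k. _ \<longrightarrow> _ \<longrightarrow> ?l k)")
proof -
  let ?f = "\<lambda>G p k. [wt G (p ! k) (p ! k), wt G (p ! k) (p ! (k + 1))]"
  let ?I = "[1..<length q - 1]"
  have "concat (map (?f G p) ?I) = concat (map (?f H q) ?I) \<longleftrightarrow> map (?f G p) ?I = map (?f H q) ?I"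
    by (rule concat_eq_concat_iff) (auto simp: zip_map_map)
  then have "Omega G p = Omega H q \<longleftrightarrow> ?e 0 \<and> (\<forall>k\<in>set ?I. ?l k \<and> ?e k)"
    unfolding Omega_def using assms(1) by auto
  also have "\<dots> \<longleftrightarrow> (\<forall>k. k + 1 < length q \<longrightarrow> ?e k) \<and> (\<forall>k. 1 \<le> k \<longrightarrow> k + 1 < length q \<longrightarrow> ?l k)"
  proof -
    have "k = 0 \<or> k \<in> set ?I" if "k + 1 < length q" for k
      using that by auto
    moreover have "1 \<le> k \<and> k + 1 < length q" if "k \<in> set ?I" for k
      using that by auto
    moreover have "0 + 1 < length q" using assms(2) by simp
    moreover have "k \<in> set ?I" if "1 \<le> k" "k + 1 < length q" for k
      using that by auto
    ultimately show ?thesis by blast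
  qed
  finally show ?thesis .
qed

lemma set_Omega:
  assumes "length p \<ge> 2"
  shows "set (Omega G p) = {wt G (p ! k) (p ! (k + 1)) | k. k + 1 < length p} \<union>
    {wt G (p ! k) (p ! k) | k. 1 \<le> k \<and> k + 1 < length p}"
proof -
  let ?I = "{1..<length p - 1}"
  have "set (Omega G p) = insert (wt G (p ! 0) (p ! (0 + 1)))
      ((\<lambda>k. wt G (p ! k) (p ! (k + 1))) ` ?I \<union> (\<lambda>k. wt G (p ! k) (p ! k)) ` ?I)"
    by (auto simp: Omega_def)
  also have "\<dots> = (\<lambda>k. wt G (p ! k) (p ! (k + 1))) ` insert 0 ?I \<union> (\<lambda>k. wt G (p ! k) (p ! k)) ` ?I"
    by simp
  also have "insert 0 ?I = {k. k + 1 < length p}" using assms by auto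
  also have "?I = {k. 1 \<le> k \<and> k + 1 < length p}" by auto
  finally show ?thesis by (simp add: image_Collect)
qed

section \<open>Interior positions and the multiplicities of vertices\<close>

lemma branches_length: "p \<in> branches G S \<Longrightarrow> length p \<ge> 2"
  by (auto simp: branches_def branches_ij_def is_path_def is_cycle_def)

lemma branches_edge: "p \<in> branches G S \<Longrightarrow> k + 1 < length p \<Longrightarrow> edge G (p ! k) (p ! (k + 1))"
  by (auto simp: branches_def branches_ij_def is_path_def is_cycle_def consec_edges_def)

lemma branches_ends: "p \<in> branches G S \<Longrightarrow> hd p \<in> S \<and> last p \<in> S"
  by (auto simp: branches_def branches_ij_def)

lemma branches_ij_iff: "i \<in> S \<Longrightarrow> j \<in> S \<Longrightarrow> p \<in> branches_ij G S i j \<longleftrightarrow> p \<in> branches G S \<and> hd p = i \<and> last p = j"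
  by (auto simp: branches_def branches_ij_def)

lemma interior_eq: "interior p = {p ! k | k. 1 \<le> k \<and> k + 1 < length p}"
proof (cases p)
  case (Cons i q)
  have "butlast q = map ((!) q) [0..<length q - 1]"
    by (rule nth_equalityI) (auto simp: nth_butlast)
  then have "set (butlast q) = {q ! k | k. k < length q - 1}"
    by auto
  also have "\<dots> = {p ! k | k. 1 \<le> k \<and> k + 1 < length p}"
  proof (intro equalityI subsetI)
    fix x assume "x \<in> {q ! k | k. k < length q - 1}"
    then obtain k where "x = p ! Suc k" "k < length q - 1" by (auto simp: Cons)
    then show "x \<in> {p ! k | k. 1 \<le> k \<and> k + 1 < length p}"
      by (intro CollectI exI[of _ "Suc k"]) (auto simp: Cons)
  next
    fix x assume "x \<in> {p ! k | k. 1 \<le> k \<and> k + 1 < length p}"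
    then obtain k where "x = p ! k" "1 \<le> k" "k + 1 < length p" by auto
    then show "x \<in> {q ! k | k. k < length q - 1}"
      by (intro CollectI exI[of _ "k - 1"]) (auto simp: Cons nth_Cons')
  qed
  finally show ?thesis by (simp add: Cons interior_Cons)
qed (simp add: interior_def)

lemma position_vertex:
  assumes "structural G S" "(p, k) \<in> positions G S"
  shows "p ! k \<in> {0..<nv G} - S" "p ! k \<in> interior p" "p ! k \<in> set p"
proof -
  have pk: "p \<in> branches G S" "1 \<le> k" "k + 1 < length p" using assms(2) by (auto simp: positions_def)
  show int: "p ! k \<in> interior p" unfolding interior_eq using pk by auto
  have "p ! k < nv G" using branches_edge[OF pk(1,3)] by (simp add: edge_def)
  then show "p ! k \<in> {0..<nv G} - S"
    using pk(1) int by (auto simp: branches_def branches_ij_def)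
  show "p ! k \<in> set p" using pk by simp
qed

text \<open>Only the two ends of a branch can coincide: without its first vertex it is distinct,
  which also explains the shift of the indices by one.\<close>

lemma position_unique:
  assumes "structural G S" "(p, k) \<in> positions G S" "(p, k') \<in> positions G S" "p ! k = p ! k'"
  shows "k = k'"
proof -
  have pk: "p \<in> branches G S" "1 \<le> k" "k + 1 < length p" "1 \<le> k'" "k' + 1 < length p"
    using assms by (auto simp: positions_def)
  then obtain i q where "p = i # q" "successively (step G S) q" by (auto simp: branches_eq[OF assms(1)])
  with pk assms(4) distinct_steps[OF assms(1), of q] have "k - 1 = k' - 1"
    by (auto simp: nth_Cons' nth_eq_iff_index_eq)
  then show ?thesis using pk by simp
qed

lemma vertex_position:
  assumes "p \<in> branches G S" "v \<in> set p" "v \<notin> S"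
  obtains k where "(p, k) \<in> positions G S" "p ! k = v"
proof -
  obtain k where k: "k < length p" "p ! k = v" using assms(2) by (auto simp: in_set_conv_nth)
  have "p \<noteq> []" using branches_length[OF assms(1)] by auto
  then have "p ! 0 \<in> S" "p ! (length p - 1) \<in> S"
    using branches_ends[OF assms(1)] by (simp_all add: hd_conv_nth last_conv_nth)
  then have "k \<noteq> 0" "k \<noteq> length p - 1"
    using k(2) assms(3) by metis+
  then show ?thesis using k assms(1) by (intro that[of k]) (auto simp: positions_def)
qed

lemma finite_positions:
  assumes "structural G S"
  shows "finite (positions G S)"
proof (rule finite_subset)
  show "positions G S \<subseteq> (SIGMA p:branches G S. {..<length p})"
    by (auto simp: positions_def)
qed (auto intro!: finite_SigmaI finite_branches[OF assms])

text \<open>A branch through a vertex outside \<open>S\<close> visits it at exactly one position, so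
  forgetting the index is a bijection.\<close>

lemma card_positions_at:
  assumes "structural G S" "v \<notin> S"
  shows "card {x \<in> positions G S. fst x ! snd x = v} = card {p \<in> branches G S. v \<in> set p}"
proof (rule bij_betw_same_card)
  show "bij_betw fst {x \<in> positions G S. fst x ! snd x = v} {p \<in> branches G S. v \<in> set p}"
  proof (rule bij_betwI')
    show "fst x = fst y \<longleftrightarrow> x = y"
      if "x \<in> {x \<in> positions G S. fst x ! snd x = v}" "y \<in> {x \<in> positions G S. fst x ! snd x = v}" for x y
      using that position_unique[OF assms(1)] by (cases x; cases y) auto
    show "fst x \<in> {p \<in> branches G S. v \<in> set p}" if "x \<in> {x \<in> positions G S. fst x ! snd x = v}" for x
      using that by (cases x) (auto simp: positions_def)
    show "\<exists>x\<in>{x \<in> positions G S. fst x ! snd x = v}. p = fst x" if p: "p \<in> {p \<in> branches G S. v \<in> set p}" for p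
    proof -
      obtain k where "(p, k) \<in> positions G S" "p ! k = v"
        using p assms(2) vertex_position by blast
      then show ?thesis by (intro bexI[of _ "(p, k)"]) auto
    qed
  qed
qed

lemma image_positions:
  assumes "structural G S" "\<forall>v < nv G. \<exists>p\<in>branches G S. v \<in> set p"
  shows "(\<lambda>(p, k). p ! k) ` positions G S = {0..<nv G} - S"
proof (intro equalityI subsetI)
  fix v assume v: "v \<in> {0..<nv G} - S"
  then obtain p where "p \<in> branches G S" "v \<in> set p" using assms(2) by auto
  with v obtain k where "(p, k) \<in> positions G S" "p ! k = v" using vertex_position by blast
  then show "v \<in> (\<lambda>(p, k). p ! k) ` positions G S" by force
qed (use position_vertex[OF assms(1)] in auto)

lemma prod_positions:
  fixes f :: "nat \<Rightarrow> 'a::comm_monoid_mult"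
  assumes "structural G S"
  shows "(\<Prod>x\<in>positions G S. f (fst x ! snd x)) =
    (\<Prod>v\<in>{0..<nv G} - S. f v ^ card {p \<in> branches G S. v \<in> set p})"
proof -
  have "(\<Prod>x\<in>positions G S. f (fst x ! snd x)) =
      (\<Prod>v\<in>{0..<nv G} - S. \<Prod>x\<in>{x \<in> positions G S. fst x ! snd x = v}. f (fst x ! snd x))"
    using position_vertex[OF assms] finite_positions[OF assms]
    by (intro prod.group[symmetric]) force+
  also have "\<dots> = (\<Prod>v\<in>{0..<nv G} - S. f v ^ card {p \<in> branches G S. v \<in> set p})"
    by (intro prod.cong) (auto simp: card_positions_at[OF assms])
  finally show ?thesis .
qed

text \<open>Splices a branch through \<open>u\<close>, cut at \<open>u\<close>, with the remainder of a branch through \<open>v\<close>.\<close>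

lemma edge_on_branch:
  assumes "structural G S" "\<forall>v < nv G. \<exists>p\<in>branches G S. v \<in> set p"
    and uv: "edge G u v" "u \<in> S \<or> u \<noteq> v"
  obtains p k where "p \<in> branches G S" "k + 1 < length p" "p ! k = u" "p ! (k + 1) = v"
proof -
  have "u < nv G" "v < nv G" using uv by (auto simp: edge_def)
  \<comment> \<open>The remainder after \<open>v\<close>: empty if \<open>v\<close> lies in
    \<open>S\<close>, otherwise cut from a branch through \<open>v\<close>.\<close>
  obtain q where q: "successively (step G S) (v # q)" "last (v # q) \<in> S"
  proof (cases "v \<in> S")
    case True
    then show ?thesis using that[of "[]"] by simp
  next
    case False
    obtain p where p: "p \<in> branches G S" "v \<in> set p" using assms(2) \<open>v < nv G\<close> by blast
    then obtain i r where r: "p = i # r" "i \<in> S" "successively (step G S) r" "last r \<in> S"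
      by (auto simp: branches_eq[OF assms(1)])
    then have "v \<in> set r" using p False by auto
    then obtain r1 r2 where "r = r1 @ v # r2" by (auto simp: in_set_conv_decomp)
    then show ?thesis using r that[of r2] by (auto simp: successively_append_iff split: if_splits)
  qed
  show ?thesis
  proof (cases "u \<in> S")
    case True
    then have "u # v # q \<in> branches G S" using q uv by (auto simp: branches_eq[OF assms(1)])
    then show ?thesis by (rule that[of _ 0]) auto
  next
    case False
    obtain p where p: "p \<in> branches G S" "u \<in> set p" using assms(2) \<open>u < nv G\<close> by blast
    then obtain i r where r: "p = i # r" "i \<in> S" "edge G i (hd r)" "successively (step G S) r"
      by (auto simp: branches_eq[OF assms(1)])
    then have "u \<in> set r" using p False by auto
    then obtain r1 r2 where r12: "r = r1 @ u # r2" by (auto simp: in_set_conv_decomp)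
    have "hd (r1 @ u # v # q) = hd r" by (cases r1) (auto simp: r12)
    moreover have "step G S u v" using False uv by (simp add: step_def)
    \<comment> \<open>Acyclicity excludes repetitions, so gluing lists of steps always gives a
      branch.\<close>
    ultimately have "i # r1 @ u # v # q \<in> branches G S"
      using r q by (auto simp: branches_eq[OF assms(1)] r12 successively_append_iff)
    then show ?thesis by (rule that[of _ "Suc (length r1)"]) (auto simp: nth_append)
  qed
qed

text \<open>Loops outside \<open>S\<close> occur as loop entries of \<open>Omega\<close>, all other
  edges as edges of branches. The value \<open>0\<close> is removed because \<open>Omega\<close>
  records it for absent loops.\<close>

lemma weight_set_eq:
  assumes "structural G S" "\<forall>v < nv G. \<exists>p\<in>branches G S. v \<in> set p"
  shows "weight_set G = (\<Union>p\<in>branches G S. set (Omega G p)) - {0}"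
proof (intro equalityI subsetI)
  fix x assume "x \<in> weight_set G"
  then obtain u v where uv: "edge G u v" "x = wt G u v" by (auto simp: weight_set_def)
  then have "x \<noteq> 0" by (simp add: edge_def)
  have "\<exists>p\<in>branches G S. x \<in> set (Omega G p)"
  proof (cases "u \<in> S \<or> u \<noteq> v")
    case True
    then obtain p k where "p \<in> branches G S" "k + 1 < length p" "p ! k = u" "p ! (k + 1) = v"
      using edge_on_branch[OF assms uv(1)] by blast
    then show ?thesis using uv(2) by (intro bexI[of _ p]) (auto simp: set_Omega branches_length)
  next
    case False
    have "u < nv G" using uv by (simp add: edge_def)
    then obtain p where p: "p \<in> branches G S" "u \<in> set p" using assms(2) by blast
    with False obtain k where "(p, k) \<in> positions G S" "p ! k = u" using vertex_position by blast
    then show ?thesis using p False uv(2)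
      by (intro bexI[of _ p]) (auto simp: set_Omega branches_length positions_def)
  qed
  then show "x \<in> (\<Union>p\<in>branches G S. set (Omega G p)) - {0}" using \<open>x \<noteq> 0\<close> by auto
next
  fix x assume "x \<in> (\<Union>p\<in>branches G S. set (Omega G p)) - {0}"
  then obtain p where p: "p \<in> branches G S" "x \<in> set (Omega G p)" "x \<noteq> 0" by auto
  then consider k where "x = wt G (p ! k) (p ! (k + 1))" "k + 1 < length p"
    | k where "x = wt G (p ! k) (p ! k)" "k + 1 < length p"
    by (auto simp: set_Omega branches_length)
  then show "x \<in> weight_set G"
  proof cases
    case 1
    then show ?thesis using branches_edge[OF p(1)] by (auto simp: weight_set_def)
  next
    case 2
    then have "p ! k < nv G" using branches_edge[OF p(1)] by (simp add: edge_def)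
    then show ?thesis using p(3) 2 by (auto simp: weight_set_def edge_def)
  qed
qed

section \<open>Transfer along the bijections of branches\<close>

lemma path_weight_Omega_cong:
  assumes "Omega H q = Omega G p" "length q \<ge> 2" "length p \<ge> 2"
  shows "path_weight H q = path_weight G p"
proof -
  have len: "length q = length p" using Omega_eq_length assms by blast
  note eq = Omega_eq_iff[OF len assms(3), of H G, THEN iffD1, OF assms(1)]
  have "wt H (q ! 0) (q ! (0 + 1)) = wt G (p ! 0) (p ! (0 + 1))"
    using eq assms(3) by (intro eq[THEN conjunct1, rule_format]) simp
  moreover have "(\<Prod>k\<in>{1..<length p - 1}. wt H (q ! k) (q ! (k + 1)) / (lam - wt H (q ! k) (q ! k))) =
      (\<Prod>k\<in>{1..<length p - 1}. wt G (p ! k) (p ! (k + 1)) / (lam - wt G (p ! k) (p ! k)))"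
    using eq by (intro prod.cong) auto
  ultimately show ?thesis by (simp add: path_weight_def len)
qed

text \<open>The bijections are given separately for each pair of ends. They preserve the ends, so
  they glue to one bijection on all branches.\<close>

lemma branch_expansion_bij:
  assumes "is_branch_expansion G S H"
  obtains b where "bij_betw b (branches H S) (branches G S)"
    and "\<And>q. q \<in> branches H S \<Longrightarrow> Omega H q = Omega G (b q)"
proof -
  have "\<forall>i\<in>S. \<exists>b. \<forall>j\<in>S. bij_betw (b j) (branches_ij H S i j) (branches_ij G S i j) \<and>
          (\<forall>q\<in>branches_ij H S i j. Omega H q = Omega G (b j q))"
    using assms unfolding is_branch_expansion_def by (intro ballI bchoice) blast
  from bchoice[OF this] obtain b where
    b: "\<And>i j. i \<in> S \<Longrightarrow> j \<in> S \<Longrightarrow> bij_betw (b i j) (branches_ij H S i j) (branches_ij G S i j)"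
    and O: "\<And>i j q. i \<in> S \<Longrightarrow> j \<in> S \<Longrightarrow> q \<in> branches_ij H S i j \<Longrightarrow> Omega H q = Omega G (b i j q)"
    by blast
  define c where "c q = b (hd q) (last q) q" for q
  have c: "c q \<in> branches G S \<and> hd (c q) = hd q \<and> last (c q) = last q \<and> Omega H q = Omega G (c q)"
    if "q \<in> branches H S" for q
  proof -
    have e: "hd q \<in> S" "last q \<in> S" and q: "q \<in> branches_ij H S (hd q) (last q)"
      using branches_ends[OF that] that by (auto simp: branches_ij_iff)
    have "c q \<in> branches_ij G S (hd q) (last q)"
      using bij_betwE[OF b[OF e]] q by (auto simp: c_def)
    then show ?thesis using O[OF e q] e by (simp add: branches_ij_iff c_def)
  qed
  have "bij_betw c (branches H S) (branches G S)"
  proof (rule bij_betwI')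
    show "c q \<in> branches G S" if "q \<in> branches H S" for q using c[OF that] by simp
    show "c q = c q' \<longleftrightarrow> q = q'" if q: "q \<in> branches H S" "q' \<in> branches H S" for q q'
    proof
      assume eq: "c q = c q'"
      have e: "hd q \<in> S" "last q \<in> S" "hd q' = hd q" "last q' = last q"
        using branches_ends[OF q(1)] c[OF q(1)] c[OF q(2)] eq by auto
      have "q \<in> branches_ij H S (hd q) (last q)" "q' \<in> branches_ij H S (hd q) (last q)"
        using q e by (auto simp: branches_ij_iff)
      moreover have "b (hd q) (last q) q = b (hd q) (last q) q'" using eq e by (simp add: c_def)
      ultimately show "q = q'" using bij_betw_imp_inj_on[OF b[OF e(1,2)]] by (auto dest: inj_onD)
    qed simp
    show "\<exists>q\<in>branches H S. p = c q" if p: "p \<in> branches G S" for p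
    proof -
      have e: "hd p \<in> S" "last p \<in> S" "p \<in> branches_ij G S (hd p) (last p)"
        using branches_ends[OF p] p by (auto simp: branches_ij_iff)
      then obtain q where "q \<in> branches_ij H S (hd p) (last p)" "p = b (hd p) (last p) q"
        using bij_betw_imp_surj_on[OF b[OF e(1,2)]] by (metis imageE)
      then show ?thesis using e by (intro bexI[of _ q]) (auto simp: c_def branches_ij_iff)
    qed
  qed
  then show ?thesis using that c by blast
qed

lemma branch_expansion_reduction:
  assumes "is_branch_expansion G S H"
  shows "reduction H S = reduction G S"
proof (intro ext)
  fix i j
  show "reduction H S i j = reduction G S i j"
  proof (cases "i \<in> S \<and> j \<in> S")
    case True
    then obtain b where b: "bij_betw b (branches_ij H S i j) (branches_ij G S i j)"
      and O: "\<And>q. q \<in> branches_ij H S i j \<Longrightarrow> Omega H q = Omega G (b q)"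
      using assms unfolding is_branch_expansion_def by meson
    have "path_weight H q = path_weight G (b q)" if "q \<in> branches_ij H S i j" for q
    proof (rule path_weight_Omega_cong[OF O[OF that]])
      have "q \<in> branches H S" "b q \<in> branches G S"
        using that bij_betwE[OF b] True by (auto simp: branches_ij_iff)
      then show "length q \<ge> 2" "length (b q) \<ge> 2" by (auto dest: branches_length)
    qed
    then have "(\<Sum>q\<in>branches_ij H S i j. path_weight H q) = (\<Sum>p\<in>branches_ij G S i j. path_weight G p)"
      by (subst sum.reindex_bij_betw[OF b, symmetric]) (rule sum.cong, auto)
    \<comment> \<open>Equal sums alone would not distinguish an absent edge from an edge of weight
      \<open>0\<close>.\<close>
    moreover have "branches_ij H S i j = {} \<longleftrightarrow> branches_ij G S i j = {}"
      using bij_betw_imp_surj_on[OF b] by blast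
    ultimately show ?thesis by (simp add: reduction_def)
  qed (auto simp: reduction_def)
qed

lemma branch_expansion_properties:
  assumes wf: "wf_graph G" and st: "structural G S"
    and cov: "\<forall>v < nv G. \<exists>p\<in>branches G S. v \<in> set p"
    and H: "is_branch_expansion G S H"
  shows "weight_set H = weight_set G"
    and "nv H \<ge> nv G"
    and "det (adj_mat H - lam \<cdot>\<^sub>m 1\<^sub>m (nv H)) =
         det (adj_mat G - lam \<cdot>\<^sub>m 1\<^sub>m (nv G)) *
         (\<Prod>i\<in>{0..<nv G} - S. (wt G i i - lam) ^ (card {p \<in> branches G S. i \<in> set p} - 1))"
proof -
  have wfH: "wf_graph H" and stH: "structural H S"
    and ind: "\<And>p q. p \<in> branches H S \<Longrightarrow> q \<in> branches H S \<Longrightarrow> p \<noteq> q \<Longrightarrow> interior p \<inter> interior q = {}"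
    and covH: "\<forall>v < nv H. \<exists>p\<in>branches H S. v \<in> set p"
    using H by (auto simp: is_branch_expansion_def independent_def)
  obtain b where b: "bij_betw b (branches H S) (branches G S)"
    and O: "\<And>q. q \<in> branches H S \<Longrightarrow> Omega H q = Omega G (b q)"
    using branch_expansion_bij[OF H] by blast
  have bq: "b q \<in> branches G S" if "q \<in> branches H S" for q
    using that bij_betwE[OF b] by blast
  have len: "length (b q) = length q" if "q \<in> branches H S" for q
    using Omega_eq_length[OF O[OF that] branches_length[OF that] branches_length[OF bq[OF that]]] by simp
  have "(\<Union>q\<in>branches H S. set (Omega H q)) = (\<Union>p\<in>branches G S. set (Omega G p))"
    using O by (simp flip: bij_betw_imp_surj_on[OF b])
  then show "weight_set H = weight_set G"
    by (simp add: weight_set_eq[OF st cov] weight_set_eq[OF stH covH])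
  \<comment> \<open>Independence forces the branches to agree, and then the indices agree as
    well.\<close>
  have inj: "inj_on (\<lambda>(p, k). p ! k) (positions H S)"
  proof (rule inj_onI, clarify)
    fix p k q l
    assume pk: "(p, k) \<in> positions H S" and ql: "(q, l) \<in> positions H S" and eq: "p ! k = q ! l"
    have "p ! k \<in> interior p \<inter> interior q"
      using position_vertex(2)[OF stH pk] position_vertex(2)[OF stH ql] eq by simp
    then have "p = q" using ind[of p q] pk ql by (auto simp: positions_def)
    then show "p = q \<and> k = l" using position_unique[OF stH pk] ql eq by auto
  qed
  then have bijH: "bij_betw (\<lambda>(p, k). p ! k) (positions H S) ({0..<nv H} - S)"
    using image_positions[OF stH covH] by (simp add: bij_betw_def)
  \<comment> \<open>A position moves to the same index on the corresponding branch; equal lengths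
    keep it interior.\<close>
  let ?c = "\<lambda>(q, k). (b q, k)"
  have bijc: "bij_betw ?c (positions H S) (positions G S)"
  proof (rule bij_betwI')
    show "?c x = ?c y \<longleftrightarrow> x = y" if "x \<in> positions H S" "y \<in> positions H S" for x y
      using that bij_betw_imp_inj_on[OF b] by (auto simp: positions_def inj_on_def)
    show "?c x \<in> positions G S" if "x \<in> positions H S" for x
      using that by (auto simp: positions_def bq len)
    show "\<exists>x\<in>positions H S. y = ?c x" if y_pos: "y \<in> positions G S" for y
    proof -
      obtain p k where y: "y = (p, k)" by (cases y)
      then have "p \<in> b ` branches H S"
        using y_pos bij_betw_imp_surj_on[OF b] by (simp add: positions_def)
      then obtain q where "q \<in> branches H S" "b q = p" by blast
      then show ?thesis using y_pos y len
        by (intro bexI[of _ "(q, k)"]) (auto simp: positions_def)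
    qed
  qed
  have SG: "S \<subseteq> {0..<nv G}" and SH: "S \<subseteq> {0..<nv H}"
    using st stH by (auto simp: structural_def)
  then have finS: "finite S" using finite_subset by blast
  \<comment> \<open>Positions cover the vertices of \<open>G\<close> outside \<open>S\<close>,
    possibly repeatedly, but match those of \<open>H\<close> one to one.\<close>
  have "card ({0..<nv G} - S) \<le> card (positions G S)"
    using card_image_le[OF finite_positions[OF st], of "\<lambda>(p, k). p ! k"] image_positions[OF st cov] by simp
  also have "\<dots> = card ({0..<nv H} - S)"
    using bij_betw_same_card[OF bijc] bij_betw_same_card[OF bijH] by simp
  finally have "nv G - card S \<le> nv H - card S"
    by (simp add: card_Diff_subset[OF finS] SG SH)
  moreover have "card S \<le> nv G" "card S \<le> nv H"
    using card_mono[OF _ SG] card_mono[OF _ SH] by simp_all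
  ultimately show "nv H \<ge> nv G" by simp
  have loops: "(\<Prod>v\<in>{0..<nv H} - S. wt H v v - lam) =
      (\<Prod>i\<in>{0..<nv G} - S. (wt G i i - lam) ^ card {p \<in> branches G S. i \<in> set p})"
  proof -
    have "(\<Prod>v\<in>{0..<nv H} - S. wt H v v - lam) =
        (\<Prod>x\<in>positions H S. wt H (fst x ! snd x) (fst x ! snd x) - lam)"
      by (subst prod.reindex_bij_betw[OF bijH, symmetric]) (simp add: case_prod_beta)
    also have "\<dots> = (\<Prod>x\<in>positions H S. wt G (fst (?c x) ! snd (?c x)) (fst (?c x) ! snd (?c x)) - lam)"
    proof (rule prod.cong[OF refl], clarify)
      fix q k assume qk: "(q, k) \<in> positions H S"
      then have q: "q \<in> branches H S" "1 \<le> k" "k + 1 < length q" by (auto simp: positions_def)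
      have "wt H (q ! k) (q ! k) = wt G (b q ! k) (b q ! k)"
        using Omega_eq_iff[of q "b q" H G] O[OF q(1)] q len[OF q(1)] branches_length[OF q(1)] by auto
      then show "wt H (fst (q, k) ! snd (q, k)) (fst (q, k) ! snd (q, k)) - lam =
          wt G (fst (b q, k) ! snd (b q, k)) (fst (b q, k) ! snd (b q, k)) - lam" by simp
    qed
    also have "\<dots> = (\<Prod>x\<in>positions G S. wt G (fst x ! snd x) (fst x ! snd x) - lam)"
      by (rule prod.reindex_bij_betw[OF bijc])
    also have "\<dots> = (\<Prod>i\<in>{0..<nv G} - S. (wt G i i - lam) ^ card {p \<in> branches G S. i \<in> set p})"
      by (rule prod_positions[OF st])
    finally show ?thesis .
  qed
  \<comment> \<open>Coverage makes each multiplicity positive, so the natural-number subtraction in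
    the exponent is not truncated.\<close>
  have pos: "card {p \<in> branches G S. i \<in> set p} > 0" if "i \<in> {0..<nv G} - S" for i
    using that cov finite_branches[OF st] by (auto simp: card_gt_0_iff)
  have "det (adj_mat H - lam \<cdot>\<^sub>m 1\<^sub>m (nv H)) = reduced_det G S *
      (\<Prod>i\<in>{0..<nv G} - S. (wt G i i - lam) ^ card {p \<in> branches G S. i \<in> set p})"
    unfolding det_reduction[OF wfH stH] loops
    by (simp add: reduced_det_def reduction_matrix_def branch_expansion_reduction[OF H])
  also have "(\<Prod>i\<in>{0..<nv G} - S. (wt G i i - lam) ^ card {p \<in> branches G S. i \<in> set p}) =
      (\<Prod>i\<in>{0..<nv G} - S. (wt G i i - lam) * (wt G i i - lam) ^ (card {p \<in> branches G S. i \<in> set p} - 1))"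
  proof (rule prod.cong[OF refl])
    fix i assume "i \<in> {0..<nv G} - S"
    from pos[OF this] show "(wt G i i - lam) ^ card {p \<in> branches G S. i \<in> set p} =
        (wt G i i - lam) * (wt G i i - lam) ^ (card {p \<in> branches G S. i \<in> set p} - 1)"
      by (simp only: power_minus_mult mult.commute[of "wt G i i - lam"])
  qed
  finally show "det (adj_mat H - lam \<cdot>\<^sub>m 1\<^sub>m (nv H)) =
         det (adj_mat G - lam \<cdot>\<^sub>m 1\<^sub>m (nv G)) *
         (\<Prod>i\<in>{0..<nv G} - S. (wt G i i - lam) ^ (card {p \<in> branches G S. i \<in> set p} - 1))"
    by (simp add: det_reduction[OF wf st] prod.distrib mult.assoc)
qed

subsection \<open>Existence of a branch expansion\<close>

text \<open>The vertices of \<open>S\<close> keep their numbers, and \<open>\<phi>\<close> gives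
  every interior position of a branch a private number among the remaining ones below
  \<open>N\<close>.\<close>

locale branch_copies =
  fixes G :: graph and S :: "nat set" and N :: nat and \<phi> :: "nat list \<times> nat \<Rightarrow> nat"
  assumes structural_G: "structural G S"
    and covered: "\<forall>v < nv G. \<exists>p\<in>branches G S. v \<in> set p"
    and S_le_N: "S \<subseteq> {0..<N}"
    and bij_\<phi>: "bij_betw \<phi> (positions G S) ({0..<N} - S)"
begin

definition pos :: "nat \<Rightarrow> nat list \<times> nat" where
  "pos = inv_into (positions G S) \<phi>"

text \<open>The vertex at index \<open>k\<close> of the copy of \<open>p\<close>. The default value
  serves the two ends, which remain in place.\<close>

definition vtx :: "nat list \<Rightarrow> nat \<Rightarrow> nat" where
  "vtx p k = (if (p, k) \<in> positions G S then \<phi> (p, k) else p ! k)"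

definition copy :: "nat list \<Rightarrow> nat list" where
  "copy p = map (vtx p) [0..<length p]"

text \<open>A vertex outside \<open>S\<close> belongs to exactly one position of one branch, so an edge incident to it
  is determined by that position; \<open>pos\<close> is meaningful only for such vertices.\<close>

definition H_wt :: "nat \<Rightarrow> nat \<Rightarrow> rf" where
  "H_wt a b =
    (if a \<in> S \<and> b \<in> S then wt G a b
     else if a \<in> {0..<N} - S then
       (let (p, k) = pos a in
        if b = a then wt G (p ! k) (p ! k)
        else if b = vtx p (k + 1) then wt G (p ! k) (p ! (k + 1)) else 0)
     else if a \<in> S \<and> b \<in> {0..<N} - S then
       (let (p, k) = pos b in if k = 1 \<and> a = p ! 0 then wt G (p ! 0) (p ! 1) else 0)
     else 0)"

definition H :: graph where "H = (N, H_wt)"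

lemma nv_H [simp]: "nv H = N" and wt_H [simp]: "wt H = H_wt"
  by (simp_all add: H_def nv_def wt_def)

lemma vtx_position:
  assumes "(p, k) \<in> positions G S"
  shows "vtx p k = \<phi> (p, k)" "vtx p k < N" "vtx p k \<notin> S" "pos (vtx p k) = (p, k)"
  using assms bij_betwE[OF bij_\<phi>] bij_betw_imp_inj_on[OF bij_\<phi>]
  by (auto simp: vtx_def pos_def inv_into_f_f)

lemma vertex_cases:
  assumes "a < N" "a \<notin> S"
  obtains p k where "(p, k) \<in> positions G S" "a = vtx p k"
proof -
  have "a \<in> \<phi> ` positions G S" using assms bij_betw_imp_surj_on[OF bij_\<phi>] by simp
  then show ?thesis using that by (auto simp: vtx_def)
qed

lemma vtx_end:
  assumes "p \<in> branches G S" "k = 0 \<or> k = length p - 1"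
  shows "vtx p k = p ! k" "vtx p k \<in> S"
proof -
  have "p \<noteq> []" using branches_length[OF assms(1)] by auto
  then have "p ! 0 \<in> S" "p ! (length p - 1) \<in> S"
    using branches_ends[OF assms(1)] by (simp_all add: hd_conv_nth last_conv_nth)
  moreover show "vtx p k = p ! k" using assms(2) by (auto simp: vtx_def positions_def)
  ultimately show "vtx p k \<in> S" using assms(2) by auto
qed

lemma position_cases:
  assumes "p \<in> branches G S" "k < length p"
  shows "(p, k) \<in> positions G S \<or> k = 0 \<or> k = length p - 1"
  using assms by (auto simp: positions_def)

lemma vtx_less: "p \<in> branches G S \<Longrightarrow> k < length p \<Longrightarrow> vtx p k < N"
  using position_cases[of p k] vtx_position(2)[of p k] vtx_end(2)[of p k] S_le_N by auto

lemma wt_edge: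
  assumes "p \<in> branches G S" "k + 1 < length p"
  shows "H_wt (vtx p k) (vtx p (k + 1)) = wt G (p ! k) (p ! (k + 1))"
proof (cases "(p, k) \<in> positions G S")
  case True
  note v = vtx_position[OF True]
  \<comment> \<open>The loop clause of \<open>H_wt\<close> takes precedence, so the successor must
    differ from the vertex itself.\<close>
  have "vtx p (k + 1) \<noteq> vtx p k"
  proof
    assume eq: "vtx p (k + 1) = vtx p k"
    then have "(p, k + 1) \<in> positions G S"
      using position_cases[OF assms] vtx_end(2)[OF assms(1)] v(3) by metis
    from vtx_position(4)[OF this] show False using v(4) eq by simp
  qed
  then show ?thesis using v by (simp add: H_wt_def)
next
  case False
  then have k: "k = 0" using assms by (auto simp: positions_def)
  have a: "vtx p 0 = p ! 0" "p ! 0 \<in> S" using vtx_end[OF assms(1), of 0] by auto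
  show ?thesis
  proof (cases "(p, 1) \<in> positions G S")
    case True
    then show ?thesis using vtx_position[OF True] a by (simp add: H_wt_def k)
  next
    case False
    then have "vtx p 1 = p ! 1" "p ! 1 \<in> S"
      using position_cases[of p 1] vtx_end[OF assms(1), of 1] assms k by auto
    then show ?thesis using a by (simp add: H_wt_def k)
  qed
qed

lemma wt_loop: "(p, k) \<in> positions G S \<Longrightarrow> H_wt (vtx p k) (vtx p k) = wt G (p ! k) (p ! k)"
  by (simp add: H_wt_def vtx_position(2-4))

text \<open>A private vertex has no way out other than along its branch. This makes \<open>H\<close>
  acyclic outside \<open>S\<close> and determines its branches.\<close>

lemma step_H:
  assumes "step H S (vtx p k) b" "(p, k) \<in> positions G S"
  shows "b = vtx p (k + 1)"
  using assms by (auto simp: step_def edge_def H_wt_def vtx_position(2-4) split: if_splits)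

lemma edge_H_from_S:
  assumes "edge H a b" "a \<in> S"
  shows "b \<in> S \<and> edge G a b \<or> (\<exists>p. (p, 1) \<in> positions G S \<and> a = p ! 0 \<and> b = vtx p 1)"
proof (cases "b \<in> S")
  case True
  then show ?thesis using assms structural_G by (auto simp: edge_def H_wt_def structural_def)
next
  case False
  moreover have "b < N" using assms by (simp add: edge_def)
  ultimately obtain p k where pk: "(p, k) \<in> positions G S" "b = vtx p k" using vertex_cases by blast
  then show ?thesis
    using assms False by (auto simp: edge_def H_wt_def vtx_position(2-4) split: if_splits)
qed

lemma wf_graph_H: "wf_graph H"
  unfolding wf_graph_def
proof (intro allI impI)
  fix a b assume ab: "nv H \<le> a \<or> nv H \<le> b"
  show "wt H a b = 0"
  proof (cases "a < N \<and> a \<notin> S")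
    case True
    then obtain p k where pk: "(p, k) \<in> positions G S" "a = vtx p k" using vertex_cases by blast
    \<comment> \<open>In the successor clause of \<open>H_wt\<close> the bound on \<open>b\<close>
      comes only from this fact.\<close>
    have "vtx p (k + 1) < N" using pk by (intro vtx_less) (auto simp: positions_def)
    moreover have "N \<le> b" "b \<noteq> a" using ab True by auto
    ultimately show ?thesis using pk by (auto simp: H_wt_def vtx_position(2-4))
  next
    case False
    then show ?thesis using ab S_le_N by (auto simp: H_wt_def)
  qed
qed

lemma structural_H: "structural H S"
proof -
  have "False" if p: "length p \<ge> 2" "hd p = last p" "set p \<subseteq> {0..<nv H} - S"
    "\<forall>k. k + 1 < length p \<longrightarrow> p ! k \<noteq> p ! (k + 1) \<and> edge H (p ! k) (p ! (k + 1))" for p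
  proof -
    \<comment> \<open>The index along the branch is a potential that grows with every step outside
      \<open>S\<close>, so no walk there can close up.\<close>
    have mono: "snd (pos (p ! k)) < snd (pos (p ! Suc k))" if "Suc k < length p" for k
    proof -
      have a: "p ! k \<in> {0..<N} - S" "p ! Suc k \<in> {0..<N} - S"
        using subsetD[OF p(3), of "p ! k"] subsetD[OF p(3), of "p ! Suc k"] that by simp_all
      then obtain q l where q: "(q, l) \<in> positions G S" "p ! k = vtx q l"
        using vertex_cases[of "p ! k"] by auto
      have "step H S (p ! k) (p ! Suc k)" using p(4) that a by (simp add: step_def)
      then have eq: "p ! Suc k = vtx q (l + 1)" using step_H q by simp
      have "q \<in> branches G S" "l + 1 < length q" using q by (auto simp: positions_def)
      then have "(q, l + 1) \<in> positions G S"
        using position_cases[of q "l + 1"] vtx_end(2)[of q "l + 1"] a eq by auto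
      then show ?thesis using q eq by (simp add: vtx_position(2-4))
    qed
    have "successively (\<lambda>a b. snd (pos a) < snd (pos b)) p"
      using mono by (simp add: successively_conv_nth)
    then have "sorted_wrt (\<lambda>a b. snd (pos a) < snd (pos b)) p"
      by (subst (asm) successively_conv_sorted_wrt) (auto intro: transpI)
    from sorted_wrt_nth_less[OF this, of 0 "length p - 1"]
    have "snd (pos (p ! 0)) < snd (pos (p ! (length p - 1)))"
      using p(1) by simp
    moreover have "p \<noteq> []" using p(1) by auto
    ultimately show False using p(2) by (simp add: hd_conv_nth last_conv_nth)
  qed
  \<comment> \<open>Private vertices inherit the loops of vertices of \<open>G\<close> outside
    \<open>S\<close>.\<close>
  moreover have "H_wt a a \<noteq> lam" if "a \<in> {0..<N} - S" for a
  proof -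
    obtain p k where pk: "(p, k) \<in> positions G S" "a = vtx p k"
      using vertex_cases[of a] \<open>a \<in> {0..<N} - S\<close> by auto
    then show ?thesis
      using position_vertex(1)[OF structural_G pk(1)] structural_G by (auto simp: wt_loop structural_def)
  qed
  ultimately show ?thesis
    unfolding structural_def using structural_G S_le_N by (auto simp: structural_def)
qed

section \<open>The branches of the expansion are the copies of the branches of
  \<open>G\<close>\<close>

lemma length_copy [simp]: "length (copy p) = length p"
  by (simp add: copy_def)

lemma nth_copy: "k < length p \<Longrightarrow> copy p ! k = vtx p k"
  by (simp add: copy_def)

lemma copy_ends:
  assumes "p \<in> branches G S"
  shows "hd (copy p) = hd p" "last (copy p) = last p"
proof -
  have "p \<noteq> []" using branches_length[OF assms] by auto
  then have "copy p \<noteq> []" by (metis length_copy length_0_conv)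
  then show "hd (copy p) = hd p" "last (copy p) = last p"
    using \<open>p \<noteq> []\<close> vtx_end(1)[OF assms, of 0] vtx_end(1)[OF assms, of "length p - 1"]
    by (simp_all add: hd_conv_nth last_conv_nth nth_copy)
qed

lemma copy_Cons:
  assumes "p \<in> branches G S"
  shows "copy p = vtx p 0 # map (vtx p) [1..<length p]"
proof -
  have "0 < length p" using branches_length[OF assms] by linarith
  from upt_conv_Cons[OF this] show ?thesis by (simp add: copy_def)
qed

lemma copy_branch:
  assumes "p \<in> branches G S"
  shows "copy p \<in> branches H S"
proof -
  have edge: "edge H (vtx p k) (vtx p (k + 1))" if "k + 1 < length p" for k
    using that branches_edge[OF assms that] wt_edge[OF assms that]
    by (simp add: edge_def vtx_less[OF assms])
  have step: "step H S (vtx p k) (vtx p (k + 1))" if k: "1 \<le> k" "k + 1 < length p" for k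
  proof -
    have pk: "(p, k) \<in> positions G S" using assms k by (simp add: positions_def)
    have "vtx p k \<noteq> vtx p (k + 1)"
    proof
      assume eq: "vtx p k = vtx p (k + 1)"
      then have "(p, k + 1) \<in> positions G S"
        using position_cases[OF assms k(2)] vtx_end(2)[OF assms] vtx_position(3)[OF pk] by metis
      then show False using vtx_position(4)[OF pk] vtx_position(4)[of p "k + 1"] eq by simp
    qed
    then show ?thesis using edge[OF k(2)] vtx_position(3)[OF pk] by (simp add: step_def)
  qed
  have ne: "1 < length p" using branches_length[OF assms] by linarith
  then have ne': "[Suc 0..<length p] \<noteq> []" by (simp add: upt_conv_Cons)
  have "successively (step H S) (map (vtx p) [1..<length p])"
    using step by (simp add: successively_conv_nth)
  moreover note copy_Cons[OF assms]
  moreover have "edge H (vtx p 0) (hd (map (vtx p) [1..<length p]))"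
    using edge[of 0] ne by (simp add: upt_conv_Cons[OF ne[unfolded One_nat_def]])
  moreover have "last (map (vtx p) [1..<length p]) \<in> S"
    using vtx_end(2)[OF assms, of "length p - 1"] ne by (simp add: last_map[OF ne'] last_upt)
  moreover have "map (vtx p) [1..<length p] \<noteq> []"
    using ne' by simp
  ultimately show ?thesis
    using vtx_end(2)[OF assms, of 0] by (simp add: branches_eq[OF structural_H])
qed

lemma Omega_copy: "p \<in> branches G S \<Longrightarrow> Omega H (copy p) = Omega G p"
  by (subst Omega_eq_iff) (auto simp: branches_length nth_copy wt_edge[simplified] wt_loop positions_def)

text \<open>Each step is forced by \<open>step_H\<close>, and the list cannot stop early because it
  must end in \<open>S\<close> while interior vertices of copies lie outside it.\<close>

lemma tail_of_copy:
  assumes "p \<in> branches G S" "1 \<le> k" "k < length p"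
    "successively (step H S) q" "q \<noteq> []" "hd q = vtx p k" "last q \<in> S"
  shows "q = map (vtx p) [k..<length p]"
  using assms(2-)
proof (induction q arbitrary: k)
  case (Cons a q)
  then have a: "a = vtx p k" by simp
  show ?case
  proof (cases "q = []")
    case True
    then have "vtx p k \<in> S" using Cons a by simp
    \<comment> \<open>The bound \<open>1 \<le> k\<close> excludes the initial end, so a vertex in
      \<open>S\<close> is the final one.\<close>
    then have "k = length p - 1"
      using position_cases[OF assms(1) Cons.prems(2)] vtx_position(3)[of p k] Cons.prems(1) by auto
    then have "Suc k = length p" using Cons.prems(2) by simp
    then have "[k..<length p] = [k]" using Cons.prems(2) by (simp add: upt_rec)
    then show ?thesis using True a by simp
  next
    case False
    then have st: "step H S (vtx p k) (hd q)" "successively (step H S) q" "last q \<in> S"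
      using Cons.prems a by (auto simp: successively_Cons)
    then have "k \<noteq> length p - 1" using vtx_end(2)[OF assms(1), of k] by (auto simp: step_def)
    then have k: "k + 1 < length p" and pk: "(p, k) \<in> positions G S"
      using Cons.prems assms(1) by (auto simp: positions_def)
    have "q = map (vtx p) [k + 1..<length p]"
      using k st False step_H[OF st(1) pk] by (intro Cons.IH) auto
    then show ?thesis using a Cons.prems(2) by (simp add: upt_conv_Cons)
  qed
qed simp

text \<open>A branch of \<open>H\<close> either is a single edge inside \<open>S\<close> or enters a
  copy at index 1 and must then follow it to the end.\<close>

lemma branches_H: "branches H S = copy ` branches G S"
proof (intro equalityI subsetI)
  fix p assume "p \<in> branches H S"
  then obtain i q where p: "p = i # q" "i \<in> S" "q \<noteq> []" "edge H i (hd q)" "last q \<in> S" "successively (step H S) q"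
    by (auto simp: branches_eq[OF structural_H])
  from edge_H_from_S[OF p(4,2)] show "p \<in> copy ` branches G S"
  proof (elim disjE conjE exE)
    assume hq: "hd q \<in> S" "edge G i (hd q)"
    then obtain j where q: "q = [j]"
      using p by (cases q) (auto simp: successively_Cons step_def)
    then have br: "[i, j] \<in> branches G S"
      using p hq by (auto simp: branches_eq[OF structural_G])
    have "copy [i, j] = [i, j]"
      using vtx_end(1)[OF br, of 0] vtx_end(1)[OF br, of 1] by (simp add: copy_def)
    then show ?thesis using br p q by (metis imageI)
  next
    fix r assume r: "(r, 1) \<in> positions G S" "i = r ! 0" "hd q = vtx r 1"
    then have br: "r \<in> branches G S" "1 < length r" by (auto simp: positions_def)
    then have "q = map (vtx r) [1..<length r]"
      using tail_of_copy[of r 1 q] p r by simp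
    then have "p = copy r" using p(1) r(2) vtx_end(1)[OF br(1), of 0] copy_Cons[OF br(1)] by simp
    then show ?thesis using br by simp
  qed
qed (auto intro: copy_branch)

lemma interior_copy:
  assumes "p \<in> branches G S"
  shows "interior (copy p) = {\<phi> (p, k) | k. (p, k) \<in> positions G S}"
proof -
  have "1 \<le> k \<and> k + 1 < length (copy p) \<longleftrightarrow> (p, k) \<in> positions G S" for k
    using assms by (simp add: positions_def)
  moreover have "copy p ! k = \<phi> (p, k)" if "(p, k) \<in> positions G S" for k
  proof -
    have "k < length p" using that by (simp add: positions_def)
    then show ?thesis using vtx_position(1)[OF that] by (simp add: nth_copy)
  qed
  ultimately show ?thesis
    unfolding interior_eq by (intro Collect_cong) metis
qed

lemma independent_copy:
  assumes "p \<in> branches G S" "p' \<in> branches G S" "p \<noteq> p'"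
  shows "interior (copy p) \<inter> interior (copy p') = {}"
  using assms bij_betw_imp_inj_on[OF bij_\<phi>] by (auto simp: interior_copy dest!: inj_onD)

text \<open>If different branches had equal copies, independence would make the interior empty. Both
  branches would then be single edges, which are determined by their ends, and copying preserves
  these.\<close>

lemma inj_on_copy: "inj_on copy (branches G S)"
proof (rule inj_onI, rule ccontr)
  fix p p' assume p: "p \<in> branches G S" "p' \<in> branches G S" "copy p = copy p'" "p \<noteq> p'"
  then have "interior (copy p) = {}" using independent_copy[OF p(1,2,4)] by simp
  then have no: "(p, 1) \<notin> positions G S" using p(1) by (auto simp: interior_copy)
  have len: "length p = length p'" using p(3) by (metis length_copy)
  have "length p = 2" using no branches_length[OF p(1)] p(1) by (auto simp: positions_def)
  then have "p = [hd p, last p]" "p' = [hd p', last p']"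
    using len by (auto simp: numeral_2_eq_2 length_Suc_conv)
  then show False using p copy_ends[OF p(1)] copy_ends[OF p(2)] by metis
qed

lemma is_branch_expansion_H: "is_branch_expansion G S H"
  unfolding is_branch_expansion_def independent_def
proof (intro conjI ballI allI impI)
  show "wf_graph H" "S \<subseteq> {0..<nv H}" "structural H S"
    using wf_graph_H structural_H S_le_N by simp_all
next
  fix i j assume ij: "i \<in> S" "j \<in> S"
  have "branches_ij K S i j = {p \<in> branches K S. hd p = i \<and> last p = j}" for K
    using branches_ij_iff[OF ij] by blast
  then have "copy ` branches_ij G S i j = branches_ij H S i j"
    by (auto simp: branches_H copy_ends)
  moreover have "inj_on copy (branches_ij G S i j)"
    by (rule inj_on_subset[OF inj_on_copy]) (auto simp: branches_ij_iff[OF ij])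
  ultimately have bij: "bij_betw copy (branches_ij G S i j) (branches_ij H S i j)"
    by (simp add: bij_betw_def)
  \<comment> \<open>The expansion requires a map from the branches of \<open>H\<close> to those of
    \<open>G\<close>, hence the inverse of \<open>copy\<close>.\<close>
  let ?b = "inv_into (branches_ij G S i j) copy"
  have "Omega H q = Omega G (?b q)" if "q \<in> branches_ij H S i j" for q
  proof -
    have "?b q \<in> branches G S" "copy (?b q) = q"
      using that bij_betwE[OF bij_betw_inv_into[OF bij]] bij_betw_inv_into_right[OF bij]
      by (auto simp: branches_ij_iff[OF ij])
    then show ?thesis using Omega_copy by metis
  qed
  then show "\<exists>b. bij_betw b (branches_ij H S i j) (branches_ij G S i j) \<and>
      (\<forall>q\<in>branches_ij H S i j. Omega H q = Omega G (b q))"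
    using bij_betw_inv_into[OF bij] by blast
next
  fix p q assume "p \<in> branches H S" "q \<in> branches H S" "p \<noteq> q"
  then show "interior p \<inter> interior q = {}"
    unfolding branches_H using independent_copy by blast
next
  fix v assume v: "v < nv H"
  show "\<exists>p\<in>branches H S. v \<in> set p"
  proof (cases "v \<in> S")
    case True
    then have "v < nv G" using structural_G by (auto simp: structural_def)
    then obtain p where p: "p \<in> branches G S" "v \<in> set p" using covered by blast
    then obtain k where k: "k < length p" "v = p ! k" by (auto simp: in_set_conv_nth)
    then have "(p, k) \<notin> positions G S" using position_vertex(1)[OF structural_G] True by blast
    then have "copy p ! k = v" using k by (simp add: nth_copy vtx_def)
    then have "v \<in> set (copy p)" using k nth_mem[of k "copy p"] by simp
    then show ?thesis using copy_branch[OF p(1)] by blast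
  next
    case False
    then obtain p k where pk: "(p, k) \<in> positions G S" "v = vtx p k"
      using vertex_cases[of v] v by auto
    then have "p \<in> branches G S" "v \<in> set (copy p)" by (auto simp: positions_def copy_def)
    then show ?thesis by (auto simp: branches_H)
  qed
qed

end

lemma branch_expansion_exists:
  assumes "structural G S" "\<forall>v < nv G. \<exists>p\<in>branches G S. v \<in> set p"
  shows "\<exists>H. is_branch_expansion G S H"
proof -
  \<comment> \<open>One number for each vertex of \<open>S\<close> and one for each position.
    Coverage gives \<open>nv G \<le> N\<close>, so the elements of \<open>S\<close> are among these
    numbers.\<close>
  define N where "N = card S + card (positions G S)"
  have S: "S \<subseteq> {0..<nv G}" using assms(1) by (simp add: structural_def)
  then have fin: "finite S" using finite_subset by blast
  have "card ({0..<nv G} - S) \<le> card (positions G S)"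
    using card_image_le[OF finite_positions[OF assms(1)], of "\<lambda>(p, k). p ! k"] image_positions[OF assms] by simp
  then have "nv G \<le> N" using card_Diff_subset[OF fin S] by (simp add: N_def)
  then have SN: "S \<subseteq> {0..<N}" using S by auto
  then have "card (positions G S) = card ({0..<N} - S)"
    by (simp add: card_Diff_subset[OF fin] N_def)
  then obtain \<phi> where "bij_betw \<phi> (positions G S) ({0..<N} - S)"
    using finite_same_card_bij[OF finite_positions[OF assms(1)]] by blast
  then interpret branch_copies G S N \<phi>
    using assms SN by unfold_locales
  show ?thesis using is_branch_expansion_H by blast
qed

theorem theorem5:
  fixes G :: graph and S :: "nat set"
  assumes "wf_graph G"
    and "structural G S"
    and "\<forall>v < nv G. \<exists>p\<in>branches G S. v \<in> set p"
  shows "(\<exists>H. is_branch_expansion G S H) \<and>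
    (\<forall>H. is_branch_expansion G S H \<longrightarrow>
       weight_set H = weight_set G \<and>
       reduction H S = reduction G S \<and>
       nv H \<ge> nv G \<and>
       det (adj_mat H - lam \<cdot>\<^sub>m 1\<^sub>m (nv H)) =
         det (adj_mat G - lam \<cdot>\<^sub>m 1\<^sub>m (nv G)) *
         (\<Prod>i\<in>{0..<nv G} - S. (wt G i i - lam) ^ (card {p \<in> branches G S. i \<in> set p} - 1)))"
  using branch_expansion_exists[OF assms(2,3)] branch_expansion_properties[OF assms]
    branch_expansion_reduction by blast

end
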